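(* Let $n\geq 3$ and let $\mathbb{Q}=\mathrm{circ}(Q_1,Q_2,\ldots,Q_n)$, where $Q_k$ is the $k$th Pell-Lucas number. Then $$\det(\mathbb{Q})=2(2-Q_{n+1})^{n-2}(2-3Q_n)+2\sum_{k=2}^{n-1}\left[(Q_{k+1}-3Q_k)(Q_n-2)^{n-k}(2-Q_{n+1})^{k-2}\right].$$
   Context: The Pell-Lucas numbers are defined by $Q_0=2$, $Q_1=2$, and $Q_k=2Q_{k-1}+Q_{k-2}$ for $k\geq 2$. For numbers $c_0,c_1,\ldots,c_{n-1}$, $\mathrm{circ}(c_0,c_1,\ldots,c_{n-1})$ denotes the $n\times n$ circulant matrix whose first row is $(c_0,c_1,\ldots,c_{n-1})$ and in which each subsequent row is the cyclic shift of the previous row one position to the right; i.e. its $(i,j)$ entry is $c_{(j-i)\bmod n}$ for $1\le i,j\le n$. *)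

theory Defs
  imports "Jordan_Normal_Form.Determinant"
begin

fun pell_lucas :: "nat \<Rightarrow> int" where
  "pell_lucas 0 = 2"
| "pell_lucas (Suc 0) = 2"
| "pell_lucas (Suc (Suc k)) = 2 * pell_lucas (Suc k) + pell_lucas k"

(* The list holds the first row. The shift is taken on integers, so that j - i is not
   truncated when j < i; for a nonempty list the residue lies in {0..<length cs}. *)
definition circ :: "'a list \<Rightarrow> 'a mat" where
  "circ cs = mat (length cs) (length cs)
     (\<lambda>(i, j). cs ! nat ((int j - int i) mod int (length cs)))"

end

theory Submission
  imports Defs
begin

text \<open>
  The recurrence makes the combination \<open>R\<^sub>i - 2 R\<^sub>i\<^sub>+\<^sub>1 - R\<^sub>i\<^sub>+\<^sub>2\<close> of rows (indices modulo \<open>n\<close>, starting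
  at \<open>0\<close>) vanish except for the entries \<open>a = 2 - Q\<^sub>n\<^sub>+\<^sub>1\<close> in column \<open>i\<close> and \<open>b = 2 - Q\<^sub>n\<close> in column
  \<open>i + 1\<close>. Apply this to the rows \<open>1, \<dots>, n - 2\<close>, and subtract three times the row \<open>0\<close> from the last
  row, which clears its first entry as \<open>Q\<^sub>2 = 3 Q\<^sub>1\<close>. What remains in the first column is \<open>Q\<^sub>1 = 2\<close>,
  and the complementary minor is bidiagonal up to its last row.
\<close>

text \<open>Induction by Laplace expansion along the first column, whose only nonzero entries can be
  \<open>a\<close> at the top and \<open>r 0\<close> at the bottom. The top minor has the same shape
  with \<open>r\<close> shifted by one, which is why the induction generalises over
  \<open>r\<close>.\<close>

lemma det_bidiagonal_last_row:
  fixes a b :: "'a :: comm_ring_1"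
  shows "det (mat (Suc m) (Suc m) (\<lambda>(i, j).
            if i = m then r j else if j = i then a else if j = Suc i then b else 0))
         = (\<Sum>j\<le>m. r j * a ^ j * (- b) ^ (m - j))"
proof (induction m arbitrary: r)
  case 0
  show ?case by (subst det_single) auto
next
  case (Suc m)
  let ?A = "mat (Suc (Suc m)) (Suc (Suc m)) (\<lambda>(i, j).
            if i = Suc m then r j else if j = i then a else if j = Suc i then b else 0)"
  have top: "mat_delete ?A 0 0 = mat (Suc m) (Suc m) (\<lambda>(i, j).
            if i = m then r (Suc j) else if j = i then a else if j = Suc i then b else 0)"
    by (rule eq_matI) (auto simp: mat_delete_def)
  \<comment> \<open>Without the last row and the first column, the superdiagonal of \<open>b\<close>
    becomes the diagonal and the \<open>a\<close> move below it. The cofactor sign later turns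
    \<open>b ^ Suc m\<close> into \<open>(- b) ^ Suc m\<close>.\<close>
  have "det (mat_delete ?A (Suc m) 0) = prod_list (diag_mat (mat_delete ?A (Suc m) 0))"
    by (rule det_lower_triangular[of "Suc m"]) (auto simp: mat_delete_def)
  also have "diag_mat (mat_delete ?A (Suc m) 0) = replicate (Suc m) b"
    by (rule nth_equalityI) (auto simp: diag_mat_def mat_delete_def simp del: upt_Suc replicate_Suc)
  finally have bot: "det (mat_delete ?A (Suc m) 0) = b ^ Suc m"
    by (simp add: prod_list_replicate)
  have "det ?A = (\<Sum>i<Suc (Suc m). ?A $$ (i, 0) * cofactor ?A i 0)"
    by (rule laplace_expansion_column) auto
  also have "\<dots> = (\<Sum>i\<in>{0, Suc m}. ?A $$ (i, 0) * cofactor ?A i 0)"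
    by (rule sum.mono_neutral_right) auto
  also have "\<dots> = a * (\<Sum>j\<le>m. r (Suc j) * a ^ j * (- b) ^ (m - j)) + r 0 * (- b) ^ Suc m"
    unfolding cofactor_def using Suc.IH[of "\<lambda>j. r (Suc j)"]
    by (simp add: top bot power_minus[of b] algebra_simps)
  also have "\<dots> = (\<Sum>j\<le>Suc m. r j * a ^ j * (- b) ^ (Suc m - j))"
    by (subst sum.atMost_Suc_shift) (simp add: sum_distrib_left algebra_simps)
  finally show ?case .
qed

lemma index_circ_pell_lucas:
  assumes "i < n" "j < n"
  shows "circ (map pell_lucas [1..<n+1]) $$ (i, j)
       = pell_lucas (Suc (nat ((int j - int i) mod int n)))"
proof -
  have "nat ((int j - int i) mod int n) < n"
    using assms by (simp add: nat_less_iff)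
  then show ?thesis
    using assms by (simp add: circ_def del: upt_Suc)
qed

text \<open>For a residue of at least 2 nothing wraps around and this is the recurrence itself.
  Residue 0 gives \<open>Q_1 - 2 Q_n - Q_(n-1) = 2 - Q_(n+1)\<close>, and residue 1 gives
  \<open>Q_2 - 2 Q_1 - Q_n = 2 - Q_n\<close>.\<close>

lemma pell_lucas_cyclic_recurrence:
  fixes d :: int
  assumes "n \<ge> 3"
  shows "pell_lucas (Suc (nat (d mod int n)))
       - 2 * pell_lucas (Suc (nat ((d - 1) mod int n)))
       - pell_lucas (Suc (nat ((d - 2) mod int n)))
       = (if d mod int n = 0 then 2 - pell_lucas (n + 1)
          else if d mod int n = 1 then 2 - pell_lucas n else 0)"
proof -
  define m where "m = nat (d mod int n)"
  have m: "d mod int n = int m" "m < n"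
    using assms by (auto simp: m_def nat_less_iff)
  have 1: "(d - 1) mod int n = (int m - 1) mod int n"
    and 2: "(d - 2) mod int n = (int m - 2) mod int n"
    by (simp_all add: m(1)[symmetric] mod_diff_left_eq)
  obtain p where p: "n = Suc (Suc (Suc p))"
    using assms by (metis Suc_le_D numeral_3_eq_3 Suc_le_mono)
  consider "m = 0" | "m = 1" | k where "m = Suc (Suc k)"
    by (metis One_nat_def not0_implies_Suc)
  then show ?thesis
  proof cases
    case 1
    have "(- 1) mod int n = int n - 1" "(- 2) mod int n = int n - 2"
      using assms by (auto simp: zmod_zminus1_eq_if)
    with 1 \<open>(d - 1) mod int n = _\<close> \<open>(d - 2) mod int n = _\<close> m show ?thesis
      by (simp add: p nat_add_distrib)
  next
    case 2
    have "(- 1) mod int n = int n - 1"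
      using assms by (auto simp: zmod_zminus1_eq_if)
    with 2 \<open>(d - 1) mod int n = _\<close> \<open>(d - 2) mod int n = _\<close> m show ?thesis
      by (simp add: p nat_add_distrib numeral_2_eq_2)
  next
    case (3 k)
    with m have "(int m - 1) mod int n = int (Suc k)" "(int m - 2) mod int n = int k"
      by auto
    with 3 \<open>(d - 1) mod int n = _\<close> \<open>(d - 2) mod int n = _\<close> m show ?thesis
      by (simp add: nat_add_distrib numeral_2_eq_2)
  qed
qed

theorem theorem2:
  fixes n :: nat
  assumes "n \<ge> 3"
  shows "det (circ (map pell_lucas [1..<n+1])) =
    2 * (2 - pell_lucas (n + 1)) ^ (n - 2) * (2 - 3 * pell_lucas n)
    + 2 * (\<Sum>k = 2..n - 1. (pell_lucas (k + 1) - 3 * pell_lucas k)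
          * (pell_lucas n - 2) ^ (n - k) * (2 - pell_lucas (n + 1)) ^ (k - 2))"
proof -
  define a b where "a = 2 - pell_lucas (n + 1)" and "b = 2 - pell_lucas n"
  \<comment> \<open>\<open>r j\<close> is the entry of the reduced last row in column
    \<open>j + 1\<close>. In the final column, \<open>j = n - 2\<close>, the cyclic shift has
    wrapped around to \<open>Q_1 = 2\<close>.\<close>
  define r where "r j = (if j = n - 2 then 2 - 3 * pell_lucas n
    else pell_lucas (j + 3) - 3 * pell_lucas (j + 2))" for j
  let ?C = "circ (map pell_lucas [1..<n+1])"
  \<comment> \<open>\<open>L\<close> encodes the row operations. The index
    \<open>(i + 2) mod n\<close> wraps only for \<open>i = n - 2\<close>, where it refers to row
    0.\<close>
  define L :: "int mat" where "L = mat n n (\<lambda>(i, k).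
    if i = 0 then (if k = 0 then 1 else 0)
    else if i = n - 1 then (if k = n - 1 then 1 else 0) - (if k = 0 then 3 else 0)
    else (if k = i then 1 else 0) - (if k = i + 1 then 2 else 0) - (if k = (i + 2) mod n then 1 else 0))"
  define M where "M = mat n n (\<lambda>(i, j).
    if i = 0 then pell_lucas (j + 1)
    else if i = n - 1 then (if j = 0 then 0 else r (j - 1))
    else if j = i then a else if j = i + 1 then b else 0)"
  have C: "?C \<in> carrier_mat n n" by (simp add: circ_def del: upt_Suc)
  have L: "L \<in> carrier_mat n n" by (simp add: L_def)
  have M: "M \<in> carrier_mat n n" by (simp add: M_def)
  obtain p where p: "n = Suc (Suc (Suc p))"
    using assms by (metis Suc_le_D numeral_3_eq_3 Suc_le_mono)

  have "L * ?C = M"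
  proof (rule eq_matI)
    fix i j assume "i < dim_row M" "j < dim_col M"
    then have ij: "i < n" "j < n" using M by auto
    let ?q = "\<lambda>k. pell_lucas (Suc (nat ((int j - int k) mod int n)))"
    have "(L * ?C) $$ (i, j) = (\<Sum>k<n. L $$ (i, k) * ?C $$ (k, j))"
      using ij L C by (simp add: scalar_prod_def lessThan_atLeast0)
    also have "\<dots> = (\<Sum>k<n. L $$ (i, k) * ?q k)"
      by (rule sum.cong) (use ij in \<open>simp_all only: index_circ_pell_lucas lessThan_iff\<close>)
    finally have eq: "(L * ?C) $$ (i, j) = (\<Sum>k<n. L $$ (i, k) * ?q k)" .
    consider "i = 0" | "i = n - 1" "i \<noteq> 0" | "i \<noteq> 0" "i < n - 1" using ij by linarith
    then show "(L * ?C) $$ (i, j) = M $$ (i, j)"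
    proof cases
      case 1
      have "(\<Sum>k<n. L $$ (i, k) * ?q k) = (\<Sum>k<n. if k = 0 then ?q 0 else 0)"
        by (rule sum.cong) (use 1 ij in \<open>auto simp: L_def\<close>)
      with eq 1 ij show ?thesis by (simp add: M_def)
    next
      case 2
      have "(\<Sum>k<n. L $$ (i, k) * ?q k)
        = (\<Sum>k<n. (if k = n - 1 then ?q (n - 1) else 0) - (if k = 0 then 3 * ?q 0 else 0))"
        by (rule sum.cong) (use 2 ij in \<open>auto simp: L_def\<close>)
      also have "\<dots> = ?q (n - 1) - 3 * ?q 0"
        using assms by (simp add: sum_subtractf)
      also have "?q (n - 1) = (if j = n - 1 then 2 else pell_lucas (j + 2))"
      proof -
        have "(int j - int (n - 1)) mod int n = (int j + 1) mod int n"
          using assms by (simp add: of_nat_diff mod_diff_eq[symmetric] algebra_simps)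
        also have "\<dots> = (if j = n - 1 then 0 else int j + 1)"
          using ij by auto
        finally show ?thesis by (simp add: nat_add_distrib)
      qed
      finally show ?thesis
        using eq 2 ij by (auto simp: M_def r_def p numeral_2_eq_2 numeral_3_eq_3)
    next
      case 3
      have "(\<Sum>k<n. L $$ (i, k) * ?q k)
        = (\<Sum>k<n. (if k = i then ?q i else 0) - (if k = i + 1 then 2 * ?q (i + 1) else 0)
             - (if k = (i + 2) mod n then ?q ((i + 2) mod n) else 0))"
        by (rule sum.cong) (use 3 ij in \<open>auto simp: L_def\<close>)
      also have "\<dots> = ?q i - 2 * ?q (i + 1) - ?q ((i + 2) mod n)"
        using assms 3 by (auto simp: sum_subtractf)
      also have "(int j - int ((i + 2) mod n)) mod int n = (int j - int i - 2) mod int n"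
        by (simp add: zmod_int mod_diff_right_eq algebra_simps)
      also have "int j - int (i + 1) = int j - int i - 1" by simp
      also have "?q i - 2 * pell_lucas (Suc (nat ((int j - int i - 1) mod int n)))
          - pell_lucas (Suc (nat ((int j - int i - 2) mod int n)))
        = (if (int j - int i) mod int n = 0 then a
           else if (int j - int i) mod int n = 1 then b else 0)"
        unfolding a_def b_def by (rule pell_lucas_cyclic_recurrence[OF assms])
      also have "(int j - int i) mod int n = (if i \<le> j then int j - int i else int j - int i + int n)"
      proof (cases "i \<le> j")
        case False
        then have "(int j - int i + int n) mod int n = int j - int i + int n"
          using ij by (intro mod_pos_pos_trivial) auto
        with False show ?thesis by simp
      qed (use ij in auto)
      \<comment> \<open>For \<open>j < i\<close> a residue 0 or 1 would force
        \<open>i = n - 1\<close>, which this case excludes; so only \<open>j = i\<close> and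
        \<open>j = i + 1\<close> survive.\<close>
      finally show ?thesis
        using eq 3 ij by (auto simp: M_def)
    qed
  qed (use L C M in auto)
  moreover have "det (L * ?C) = det L * det ?C"
    using L C by (rule det_mult)
  moreover have "det L = 1"
  proof -
    \<comment> \<open>Row 0 of \<open>L\<close> is a unit vector. The entries of \<open>L\<close>
      below the diagonal, namely the \<open>- 3\<close> and the wrapped \<open>- 1\<close>, lie in
      column 0, so the remaining minor is upper triangular with unit diagonal.\<close>
    have "det L = (\<Sum>j<n. L $$ (0, j) * cofactor L 0 j)"
      by (rule laplace_expansion_row) (use L assms in auto)
    also have "\<dots> = (\<Sum>j\<in>{0}. L $$ (0, j) * cofactor L 0 j)"
      by (rule sum.mono_neutral_right) (use assms in \<open>auto simp: L_def\<close>)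
    also have "\<dots> = det (mat_delete L 0 0)"
      using assms by (simp add: L_def cofactor_def)
    also have "\<dots> = prod_list (diag_mat (mat_delete L 0 0))"
      by (rule det_upper_triangular[of _ "n - 1"])
        (auto simp: mat_delete_def L_def p upper_triangular_def mod_Suc)
    also have "diag_mat (mat_delete L 0 0) = replicate (n - 1) 1"
      by (rule nth_equalityI)
        (auto simp: diag_mat_def mat_delete_def L_def p mod_Suc simp del: upt_Suc replicate_Suc)
    finally show ?thesis by simp
  qed
  ultimately have "det ?C = det M" by simp
  also have "\<dots> = (\<Sum>i<n. M $$ (i, 0) * cofactor M i 0)"
    by (rule laplace_expansion_column) (use M assms in auto)
  also have "\<dots> = (\<Sum>i\<in>{0}. M $$ (i, 0) * cofactor M i 0)"
    by (rule sum.mono_neutral_right) (use assms in \<open>auto simp: M_def\<close>)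
  also have "\<dots> = 2 * det (mat_delete M 0 0)"
    using assms by (simp add: M_def cofactor_def)
  also have "mat_delete M 0 0 = mat (Suc (n - 2)) (Suc (n - 2)) (\<lambda>(i, j).
      if i = n - 2 then r j else if j = i then a else if j = Suc i then b else 0)"
    by (rule eq_matI) (auto simp: mat_delete_def M_def p)
  also have "det \<dots> = (\<Sum>j\<le>n - 2. r j * a ^ j * (- b) ^ (n - 2 - j))"
    by (rule det_bidiagonal_last_row)
  \<comment> \<open>The term \<open>j = n - 2\<close> is the exceptional value of \<open>r\<close>;
    it carries no factor \<open>- b\<close> and yields the isolated summand of the formula.\<close>
  also have "\<dots> = a ^ (n - 2) * (2 - 3 * pell_lucas n)
      + (\<Sum>j<n - 2. r j * a ^ j * (- b) ^ (n - 2 - j))"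
    by (simp add: lessThan_Suc_atMost[symmetric] r_def)
  \<comment> \<open>Substituting \<open>k = j + 2\<close> matches the indices of the claim, and
    \<open>- b\<close> is \<open>Q_n - 2\<close>.\<close>
  also have "(\<Sum>j<n - 2. r j * a ^ j * (- b) ^ (n - 2 - j))
      = (\<Sum>k = 2..n - 1. (pell_lucas (k + 1) - 3 * pell_lucas k) * (- b) ^ (n - k) * a ^ (k - 2))"
    by (rule sum.reindex_bij_witness[of _ "\<lambda>k. k - 2" "\<lambda>j. j + 2"])
      (use assms in \<open>auto simp: r_def eval_nat_numeral\<close>)
  finally show ?thesis
    by (simp add: a_def b_def algebra_simps)
qed

end
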